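(* Let $G = F(a,b)\times F(c,d)$ be the direct product of two free groups of rank $2$, let $t=db^{-1}\in G$, and let $\Gamma=\mathrm{Cay}(G,\{a,b,c,t\})$. For every integer $n\ge 0$, the word $$w_n = t^n c\, t^{-n} a\, t^n c^{-1} t^{-n} a^{-1}$$ of length $4n+4$ represents the identity in $G$ and defines an isometrically embedded cycle in $\Gamma$. In particular, there is no upper bound on the lengths of isometrically embedded cycles in $\Gamma$.
   Context: $\Gamma$ is equipped with the path metric in which each edge has length $1$. A word of length $N$ in the generators and their inverses that represents the identity defines a closed edge-path of length $N$ in $\Gamma$, beginning and ending at $1$, i.e. a combinatorial map $C_N\to\Gamma$ from the cycle graph with $N$ edges. It defines an isometrically embedded cycle when this map is distance-preserving, where $C_N$ carries its path metric with edges of length $1$. *)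

theory Defs
  imports "HOL-Algebra.Group" "Graph_Theory.Digraph" "HOL-Library.Extended_Real"
begin

section \<open>Words and free groups\<close>

text \<open>A word in the symbols of a set and their formal inverses: the letter \<open>(x, True)\<close> stands
  for \<open>x\<close>, the letter \<open>(x, False)\<close> for \<open>x\<inverse>\<close>.\<close>

type_synonym 'x word = "('x \<times> bool) list"

definition flip :: "'x \<times> bool \<Rightarrow> 'x \<times> bool" where
  "flip l = (fst l, \<not> snd l)"

definition reduced :: "'x word \<Rightarrow> bool" where
  "reduced w \<longleftrightarrow> successively (\<lambda>l m. m \<noteq> flip l) w"

fun push :: "'x \<times> bool \<Rightarrow> 'x word \<Rightarrow> 'x word" where
  "push l [] = [l]"
| "push l (m # w) = (if m = flip l then w else l # m # w)"

definition reduce :: "'x word \<Rightarrow> 'x word" where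
  "reduce w = foldr push w []"

text \<open>The free group on \<open>X\<close>, realised as the set of reduced words.\<close>

definition free_group :: "'x set \<Rightarrow> 'x word monoid" where
  "free_group X = \<lparr>carrier = {w \<in> lists (X \<times> UNIV). reduced w},
                   mult = (\<lambda>u v. reduce (u @ v)),
                   one = []\<rparr>"

lemma flip_flip [simp]: "flip (flip l) = l"
  by (simp add: flip_def)

lemma reduced_push: "reduced w \<Longrightarrow> reduced (push l w)"
  by (cases w) (auto simp: reduced_def successively_Cons)

lemma push_push_flip: "reduced w \<Longrightarrow> push l (push (flip l) w) = w"
  by (cases w rule: remdups_adj.cases) (auto simp: reduced_def)

lemma reduced_foldr_push: "reduced z \<Longrightarrow> reduced (foldr push w z)"
  by (induction w) (auto simp: reduced_push)

lemma reduced_reduce: "reduced (reduce w)"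
  unfolding reduce_def by (rule reduced_foldr_push) (simp add: reduced_def)

lemma reduce_reduced: "reduced w \<Longrightarrow> reduce w = w"
proof (induction w)
  case (Cons l w)
  then have "reduce w = w"
    by (auto simp: reduced_def successively_Cons)
  with Cons.prems show ?case
    by (cases w) (auto simp: reduce_def reduced_def)
qed (simp add: reduce_def)

lemma foldr_push_push:
  assumes "reduced z" shows "foldr push (push l w) z = push l (foldr push w z)"
  using push_push_flip[OF reduced_foldr_push[OF assms]] by (cases w) auto

lemma foldr_push_reduce:
  "reduced z \<Longrightarrow> foldr push (reduce w) z = foldr push w z"
  unfolding reduce_def by (induction w) (auto simp: foldr_push_push)

lemma reduce_append_left: "reduce (reduce u @ v) = reduce (u @ v)"
  using foldr_push_reduce[of "reduce v" u] reduced_reduce[of v] by (simp add: reduce_def)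

lemma reduce_append_right: "reduce (u @ reduce v) = reduce (u @ v)"
  using reduce_reduced[OF reduced_reduce[of v]] by (simp add: reduce_def)

lemma push_in_lists: "l \<in> A \<Longrightarrow> w \<in> lists A \<Longrightarrow> push l w \<in> lists A"
  by (cases w) auto

lemma reduce_in_lists: "w \<in> lists A \<Longrightarrow> reduce w \<in> lists A"
  unfolding reduce_def
proof (induction w)
  case (Cons l w)
  then show ?case using push_in_lists[of l A "foldr push w []"] by simp
qed simp

lemma reduce_inverse: "reduce (rev (map flip w) @ w) = []"
proof (induction w)
  case (Cons l w)
  have "foldr push (rev (map flip w)) (push (flip l) (push l (reduce w)))
      = foldr push (rev (map flip w)) (reduce w)"
    using push_push_flip[OF reduced_reduce, of "flip l" w] by simp
  with Cons show ?case by (simp add: reduce_def)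
qed (simp add: reduce_def)

lemma group_free_group: "group (free_group X)"
proof (rule groupI)
  fix u v assume "u \<in> carrier (free_group X)" "v \<in> carrier (free_group X)"
  then show "u \<otimes>\<^bsub>free_group X\<^esub> v \<in> carrier (free_group X)"
    using reduce_in_lists[of "u @ v" "X \<times> UNIV"]
    by (auto simp: free_group_def reduced_reduce)
next
  fix u assume u: "u \<in> carrier (free_group X)"
  let ?v = "reduce (rev (map flip u))"
  have "rev (map flip u) \<in> lists (X \<times> UNIV)"
    using u by (fastforce simp: free_group_def flip_def)
  then have "?v \<in> carrier (free_group X)"
    using reduce_in_lists[of _ "X \<times> UNIV"] by (auto simp: free_group_def reduced_reduce)
  moreover have "?v \<otimes>\<^bsub>free_group X\<^esub> u = \<one>\<^bsub>free_group X\<^esub>"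
    by (simp add: free_group_def reduce_append_left reduce_inverse)
  ultimately show "\<exists>v \<in> carrier (free_group X). v \<otimes>\<^bsub>free_group X\<^esub> u = \<one>\<^bsub>free_group X\<^esub>" ..
qed (auto simp: free_group_def reduce_append_left reduce_append_right reduce_reduced,
     simp add: reduced_def)


section \<open>Metric graphs\<close>

text \<open>An undirected multigraph is given by a digraph that contains exactly one arc for each edge; the
  arc only serves to parametrise the edge by \<open>[0, 1]\<close>.  In the geometric realisation,
  \<open>Inner e x\<close> with \<open>0 < x < 1\<close> is the point at distance \<open>x\<close> from the tail along the edge \<open>e\<close>.\<close>

datatype ('v, 'e) point = Vertex 'v | Inner 'e real

definition realization :: "('v, 'e) pre_digraph \<Rightarrow> ('v, 'e) point set" where
  "realization \<Gamma> = Vertex ` verts \<Gamma> \<union> {Inner e x | e x. e \<in> arcs \<Gamma> \<and> 0 < x \<and> x < 1}"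

definition edge_point :: "('v, 'e) pre_digraph \<Rightarrow> 'e \<Rightarrow> real \<Rightarrow> ('v, 'e) point" where
  "edge_point \<Gamma> e x =
     (if x = 0 then Vertex (tail \<Gamma> e) else if x = 1 then Vertex (head \<Gamma> e) else Inner e x)"

text \<open>\<open>pl_path \<Gamma> p r q\<close>: there is a piecewise linear path of length \<open>r\<close> from \<open>p\<close> to \<open>q\<close>, that is, a
  finite concatenation of linearly parametrised segments, each inside a single edge.\<close>

inductive pl_path ::
  "('v, 'e) pre_digraph \<Rightarrow> ('v, 'e) point \<Rightarrow> real \<Rightarrow> ('v, 'e) point \<Rightarrow> bool"
  for \<Gamma> where
  refl: "p \<in> realization \<Gamma> \<Longrightarrow> pl_path \<Gamma> p 0 p"
| step: "\<lbrakk>e \<in> arcs \<Gamma>; x \<in> {0..1}; y \<in> {0..1}; pl_path \<Gamma> (edge_point \<Gamma> e y) r q\<rbrakk>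
          \<Longrightarrow> pl_path \<Gamma> (edge_point \<Gamma> e x) (\<bar>x - y\<bar> + r) q"

text \<open>The path metric with edges of length 1; it is \<open>\<infinity>\<close> between different components.\<close>

definition path_dist ::
  "('v, 'e) pre_digraph \<Rightarrow> ('v, 'e) point \<Rightarrow> ('v, 'e) point \<Rightarrow> ereal" where
  "path_dist \<Gamma> p q = (INF r \<in> {r. pl_path \<Gamma> p r q}. ereal r)"

definition cycle_graph :: "nat \<Rightarrow> (nat, nat) pre_digraph" where
  "cycle_graph N =
     \<lparr>verts = {..<N}, arcs = {..<N}, tail = (\<lambda>i. i), head = (\<lambda>i. Suc i mod N)\<rparr>"

lemma wf_digraph_cycle_graph: "wf_digraph (cycle_graph N)"
  by unfold_locales (auto simp: cycle_graph_def)


section \<open>Cayley graphs and the closed edge-paths defined by words\<close>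

definition cayley_graph ::
  "('g, 'm) monoid_scheme \<Rightarrow> 'g set \<Rightarrow> ('g, 'g \<times> 'g) pre_digraph" where
  "cayley_graph G S =
     \<lparr>verts = carrier G, arcs = carrier G \<times> S, tail = fst, head = (\<lambda>(g, s). g \<otimes>\<^bsub>G\<^esub> s)\<rparr>"

lemma wf_digraph_cayley_graph:
  assumes "group G" "S \<subseteq> carrier G" shows "wf_digraph (cayley_graph G S)"
proof -
  interpret group G by fact
  show ?thesis using assms(2) by unfold_locales (auto simp: cayley_graph_def)
qed

definition letter_value :: "('g, 'm) monoid_scheme \<Rightarrow> 'g \<times> bool \<Rightarrow> 'g" where
  "letter_value G l = (if snd l then fst l else inv\<^bsub>G\<^esub> fst l)"

definition word_value :: "('g, 'm) monoid_scheme \<Rightarrow> 'g word \<Rightarrow> 'g" where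
  "word_value G w = foldr (\<lambda>l g. letter_value G l \<otimes>\<^bsub>G\<^esub> g) w \<one>\<^bsub>G\<^esub>"

text \<open>The combinatorial map from \<open>cycle_graph (length w)\<close> to the Cayley graph that reads the word
  \<open>w\<close> starting at the identity.  A letter \<open>s\<inverse>\<close> read at \<open>g\<close> traverses the edge
  \<open>(g \<otimes> s\<inverse>, s)\<close> from its head to its tail.\<close>

fun word_map ::
  "('g, 'm) monoid_scheme \<Rightarrow> 'g word \<Rightarrow> (nat, nat) point \<Rightarrow> ('g, 'g \<times> 'g) point" where
  "word_map G w (Vertex i) = Vertex (word_value G (take i w))"
| "word_map G w (Inner i x) =
     (if snd (w ! i) then Inner (word_value G (take i w), fst (w ! i)) x
      else Inner (word_value G (take (Suc i) w), fst (w ! i)) (1 - x))"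

definition isometric_cycle :: "('g, 'm) monoid_scheme \<Rightarrow> 'g set \<Rightarrow> 'g word \<Rightarrow> bool" where
  "isometric_cycle G S w \<longleftrightarrow>
     w \<noteq> [] \<and> w \<in> lists (S \<times> UNIV) \<and> word_value G w = \<one>\<^bsub>G\<^esub> \<and>
     (\<forall>p \<in> realization (cycle_graph (length w)). \<forall>q \<in> realization (cycle_graph (length w)).
        path_dist (cayley_graph G S) (word_map G w p) (word_map G w q)
          = path_dist (cycle_graph (length w)) p q)"


section \<open>The group \<open>F(a,b) \<times> F(c,d)\<close>\<close>

datatype symbol = sym_a | sym_b | sym_c | sym_d

definition FxF :: "(symbol word \<times> symbol word) monoid" where
  "FxF = free_group {sym_a, sym_b} \<times>\<times> free_group {sym_c, sym_d}"

lemma group_FxF: "group FxF"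
  unfolding FxF_def by (intro DirProd_group group_free_group)

definition gen_a :: "symbol word \<times> symbol word" where
  "gen_a = ([(sym_a, True)], [])"

definition gen_b :: "symbol word \<times> symbol word" where
  "gen_b = ([(sym_b, True)], [])"

definition gen_c :: "symbol word \<times> symbol word" where
  "gen_c = ([], [(sym_c, True)])"

definition gen_d :: "symbol word \<times> symbol word" where
  "gen_d = ([], [(sym_d, True)])"

definition gen_t :: "symbol word \<times> symbol word" where
  "gen_t = gen_d \<otimes>\<^bsub>FxF\<^esub> inv\<^bsub>FxF\<^esub> gen_b"

definition gens :: "(symbol word \<times> symbol word) set" where
  "gens = {gen_a, gen_b, gen_c, gen_t}"

definition w_word :: "nat \<Rightarrow> (symbol word \<times> symbol word) word" where
  "w_word n =
     replicate n (gen_t, True) @ [(gen_c, True)] @ replicate n (gen_t, False) @ [(gen_a, True)] @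
     replicate n (gen_t, True) @ [(gen_c, False)] @ replicate n (gen_t, False) @ [(gen_a, False)]"

end

theory Submission
  imports Defs "HOL-Library.Sublist"
begin

text \<open>An element of \<open>F(a,b) \<times> F(c,d)\<close> is recorded by the exponent sums of \<open>t\<close> and \<open>b\<close> and by two bits:
  on which side it lies of the edge from \<open>1\<close> to \<open>a\<close> in the tree of the first factor, and of the edge
  from \<open>d\<^sup>n\<close> to \<open>d\<^sup>nc\<close> in the tree of the second.  The first bit can change only where the exponent
  sums of \<open>t\<close> and \<open>b\<close> agree, the second only where the exponent sum of \<open>t\<close> is \<open>n\<close>.  On the cycle the
  exponent sum of \<open>b\<close> is always 0, so a shortcut would have to pay for moving it to the diagonal and
  back.  This yields, for each vertex of the cycle, a function that is 1-Lipschitz on the Cayley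
  graph and restricts to the distance from that vertex along the cycle.\<close>

section \<open>Piecewise linear paths\<close>

lemma edge_point_in_realization:
  assumes "wf_digraph \<Gamma>" "e \<in> arcs \<Gamma>" "x \<in> {0..1}"
  shows "edge_point \<Gamma> e x \<in> realization \<Gamma>"
  using assms wf_digraph.tail_in_verts[of \<Gamma> e] wf_digraph.head_in_verts[of \<Gamma> e]
  by (auto simp: edge_point_def realization_def)

lemma pl_path_segment:
  assumes "wf_digraph \<Gamma>" "e \<in> arcs \<Gamma>" "x \<in> {0..1}" "y \<in> {0..1}"
  shows "pl_path \<Gamma> (edge_point \<Gamma> e x) \<bar>x - y\<bar> (edge_point \<Gamma> e y)"
  using pl_path.step[OF assms(2-4) pl_path.refl[OF edge_point_in_realization[OF assms(1,2,4)]]]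
  by simp

lemma pl_path_trans:
  assumes "pl_path \<Gamma> p r q" "pl_path \<Gamma> q s z"
  shows "pl_path \<Gamma> p (r + s) z"
  using assms
proof (induction rule: pl_path.induct)
  case (step e x y r q)
  then show ?case
    using pl_path.step[of e \<Gamma> x y "r + s" z] by (simp add: add.assoc)
qed simp

lemma pl_path_sym:
  assumes "pl_path \<Gamma> p r q" "wf_digraph \<Gamma>"
  shows "pl_path \<Gamma> q r p"
  using assms
proof (induction rule: pl_path.induct)
  case (step e x y r q)
  then show ?case
    using pl_path_trans[OF step.IH pl_path_segment[of \<Gamma> e y x]]
    by (simp add: add.commute abs_minus_commute)
qed (rule pl_path.refl)

text \<open>The triangle inequality adds up the estimates on the single segments, so bounding path
  lengths from below only takes a function that is 1-Lipschitz inside each edge.\<close>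

lemma pl_path_lipschitz:
  assumes "pl_path \<Gamma> p r q"
    and "\<And>e x y. \<lbrakk>e \<in> arcs \<Gamma>; x \<in> {0..1}; y \<in> {0..1}\<rbrakk>
      \<Longrightarrow> \<bar>h (edge_point \<Gamma> e x) - h (edge_point \<Gamma> e y)\<bar> \<le> \<bar>x - y\<bar>"
  shows "\<bar>h p - h q\<bar> \<le> r"
  using assms(1)
proof (induction rule: pl_path.induct)
  case (step e x y r q)
  then show ?case using assms(2)[of e x y] by linarith
qed simp

lemma path_dist_eqI:
  assumes "\<And>r. pl_path \<Gamma> p r q \<Longrightarrow> \<exists>s \<le> r. pl_path \<Delta> p' s q'"
    and "\<And>r. pl_path \<Delta> p' r q' \<Longrightarrow> \<exists>s \<le> r. pl_path \<Gamma> p s q"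
  shows "path_dist \<Gamma> p q = path_dist \<Delta> p' q'"
  unfolding path_dist_def
proof (rule antisym; rule INF_mono)
  fix r assume "r \<in> {r. pl_path \<Delta> p' r q'}"
  then show "\<exists>s \<in> {r. pl_path \<Gamma> p r q}. ereal s \<le> ereal r" using assms(2) by auto
next
  fix r assume "r \<in> {r. pl_path \<Gamma> p r q}"
  then show "\<exists>s \<in> {r. pl_path \<Delta> p' r q'}. ereal s \<le> ereal r" using assms(1) by auto
qed


section \<open>Cycle graphs\<close>

definition cycle_dist :: "nat \<Rightarrow> nat \<Rightarrow> nat \<Rightarrow> int" where
  "cycle_dist N k l = min \<bar>int k - int l\<bar> (int N - \<bar>int k - int l\<bar>)"

lemma cycle_dist_0_iff: "k < N \<Longrightarrow> l < N \<Longrightarrow> cycle_dist N k l = 0 \<longleftrightarrow> k = l"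
  by (auto simp: cycle_dist_def)

lemma cycle_dist_Suc:
  assumes "k < N" "2 \<le> N"
  shows "cycle_dist N k (Suc k mod N) = 1" "cycle_dist N (Suc k mod N) k = 1"
  using assms by (auto simp: cycle_dist_def mod_Suc)

lemma realization_cycle_graph:
  assumes "p \<in> realization (cycle_graph N)"
  obtains e x where "e < N" "0 \<le> x" "x < 1" "p = edge_point (cycle_graph N) e x"
proof (cases p)
  case (Vertex i)
  then show ?thesis using that[of i 0] assms
    by (auto simp: realization_def cycle_graph_def edge_point_def)
next
  case (Inner e x)
  then show ?thesis using that[of e x] assms
    by (auto simp: realization_def cycle_graph_def edge_point_def)
qed

lemma pl_path_cycle_arc:
  assumes "e < N" "x \<in> {0..1}" "y \<in> {0..1}"
  shows "pl_path (cycle_graph N) (edge_point (cycle_graph N) e x) \<bar>x - y\<bar> (edge_point (cycle_graph N) e y)"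
  using pl_path_segment[OF wf_digraph_cycle_graph _ assms(2,3)] assms(1) by (simp add: cycle_graph_def)

lemma pl_path_cycle_forward:
  assumes "k < N"
  shows "pl_path (cycle_graph N) (Vertex k) (real m) (Vertex ((k + m) mod N))"
proof (induction m)
  case 0
  then show ?case using assms by (auto intro!: pl_path.refl simp: realization_def cycle_graph_def)
next
  case (Suc m)
  have "pl_path (cycle_graph N) (Vertex ((k + m) mod N)) 1 (Vertex (Suc ((k + m) mod N) mod N))"
    using pl_path_cycle_arc[of "(k + m) mod N" N 0 1] assms
    by (simp add: edge_point_def cycle_graph_def)
  from pl_path_trans[OF Suc this] show ?case by (simp add: mod_Suc_eq add.commute)
qed

lemma pl_path_cycle_dist_le:
  assumes "k \<le> l" "l < N"
  shows "pl_path (cycle_graph N) (Vertex k) (cycle_dist N k l) (Vertex l)"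
proof (cases "cycle_dist N k l = int (l - k)")
  case True
  then show ?thesis using pl_path_cycle_forward[of k N "l - k"] assms by simp
next
  case False
  then have *: "real_of_int (cycle_dist N k l) = real (N - (l - k))"
    using assms by (auto simp: cycle_dist_def min_def split: if_splits)
  \<comment> \<open>The shorter arc now runs forward from \<open>l\<close> through the vertex 0 to
    \<open>k\<close>; it is read backwards.\<close>
  have "(l + (N - (l - k))) mod N = k"
    using assms by (simp add: mod_if)
  then show ?thesis unfolding *
    using pl_path_sym[OF pl_path_cycle_forward[of l N "N - (l - k)"] wf_digraph_cycle_graph] assms
    by simp
qed

lemma pl_path_cycle_dist:
  assumes "k < N" "l < N"
  shows "pl_path (cycle_graph N) (Vertex k) (cycle_dist N k l) (Vertex l)"
proof (cases "k \<le> l")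
  case False
  then show ?thesis
    using pl_path_sym[OF pl_path_cycle_dist_le[of l k N] wf_digraph_cycle_graph] assms
    by (simp add: cycle_dist_def abs_minus_commute)
qed (use assms pl_path_cycle_dist_le in auto)


section \<open>Isometric cycles from potentials\<close>

lemma word_value_in_carrier:
  assumes "group G" "S \<subseteq> carrier G" "w \<in> lists (S \<times> UNIV)"
  shows "word_value G w \<in> carrier G"
proof -
  interpret group G by fact
  show ?thesis using assms(2,3)
    by (induction w) (auto simp: word_value_def letter_value_def)
qed

lemma word_value_snoc:
  assumes "group G" "S \<subseteq> carrier G" "w \<in> lists (S \<times> UNIV)" "l \<in> S \<times> UNIV"
  shows "word_value G (w @ [l]) = word_value G w \<otimes>\<^bsub>G\<^esub> letter_value G l"
proof -
  interpret group G by fact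
  have l: "letter_value G l \<in> carrier G" using assms(2,4) by (auto simp: letter_value_def)
  show ?thesis using assms(3)
  proof (induction w)
    case Nil
    then show ?case using l by (simp add: word_value_def)
  next
    case (Cons m w)
    have m: "letter_value G m \<in> carrier G" using assms(2) Cons.hyps by (auto simp: letter_value_def mem_Times_iff)
    have w: "word_value G w \<in> carrier G"
      using word_value_in_carrier[OF assms(1,2)] Cons.hyps by simp
    have "word_value G ((m # w) @ [l]) = letter_value G m \<otimes>\<^bsub>G\<^esub> word_value G (w @ [l])"
      by (simp add: word_value_def)
    also have "\<dots> = letter_value G m \<otimes>\<^bsub>G\<^esub> word_value G w \<otimes>\<^bsub>G\<^esub> letter_value G l"
      using Cons l m w by (simp add: m_assoc)
    finally show ?case by (simp add: word_value_def)
  qed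
qed

locale closed_word = group G for G (structure) +
  fixes S w
  assumes S_carrier: "S \<subseteq> carrier G"
    and w_lists: "w \<in> lists (S \<times> UNIV)"
    and w_closed: "word_value G w = \<one>"
begin

abbreviation N where "N \<equiv> length w"
abbreviation C where "C \<equiv> cycle_graph N"
abbreviation \<Gamma> where "\<Gamma> \<equiv> cayley_graph G S"

definition vertex :: "nat \<Rightarrow> 'a" where
  "vertex k = word_value G (take k w)"

definition arc :: "nat \<Rightarrow> 'a \<times> 'a" where
  "arc k = (if snd (w ! k) then vertex k else vertex (Suc k), fst (w ! k))"

text \<open>An inverse letter runs along \<open>arc k\<close> from head to tail, so the coordinate
  on the \<open>k\<close>-th edge of the cycle is reversed there.\<close>

definition orient :: "nat \<Rightarrow> real \<Rightarrow> real" where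
  "orient k x = (if snd (w ! k) then x else 1 - x)"

lemma wf_\<Gamma>: "wf_digraph \<Gamma>"
  by (rule wf_digraph_cayley_graph[OF is_group S_carrier])

lemma vertex_carrier: "vertex k \<in> carrier G"
  unfolding vertex_def using word_value_in_carrier[OF is_group S_carrier] w_lists
  by (auto dest: in_set_takeD)

lemma nth_w: "k < N \<Longrightarrow> w ! k \<in> S \<times> UNIV"
  using w_lists by (meson in_lists_conv_set nth_mem)

lemma vertex_Suc: "k < N \<Longrightarrow> vertex (Suc k) = vertex k \<otimes> letter_value G (w ! k)"
  unfolding vertex_def take_Suc_conv_app_nth
  by (rule word_value_snoc[OF is_group S_carrier]) (use w_lists nth_w in \<open>auto dest: in_set_takeD\<close>)

lemma vertex_Suc_mod: "k < N \<Longrightarrow> vertex (Suc k mod N) = vertex (Suc k)"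
  using w_closed by (auto simp: mod_Suc vertex_def word_value_def)

lemma arc_in_arcs: "k < N \<Longrightarrow> arc k \<in> arcs \<Gamma>"
  using nth_w[of k] vertex_carrier by (auto simp: arc_def cayley_graph_def)

lemma arc_ends:
  assumes "k < N"
  shows "tail \<Gamma> (arc k) = (if snd (w ! k) then vertex k else vertex (Suc k mod N))"
    and "head \<Gamma> (arc k) = (if snd (w ! k) then vertex (Suc k mod N) else vertex k)"
  using nth_w[OF assms] S_carrier vertex_carrier[of k] vertex_Suc_mod[OF assms] vertex_Suc[OF assms]
  by (auto simp: arc_def cayley_graph_def letter_value_def m_assoc subset_iff mem_Times_iff)

lemma word_map_edge_point:
  assumes "k < N"
  shows "word_map G w (edge_point C k x) = edge_point \<Gamma> (arc k) (orient k x)"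
  using arc_ends[OF assms]
  by (auto simp: edge_point_def orient_def arc_def cycle_graph_def vertex_def)

lemma orient_in: "x \<in> {0..1} \<Longrightarrow> orient k x \<in> {0..1}"
  by (auto simp: orient_def)

lemma orient_diff: "\<bar>orient k x - orient k y\<bar> = \<bar>x - y\<bar>"
  by (auto simp: orient_def)

text \<open>Easy half of the isometry: segments go to segments of the same length inside single
  arcs, so the word map does not increase distances.\<close>

lemma pl_path_word_map:
  assumes "pl_path C p r q"
  shows "pl_path \<Gamma> (word_map G w p) r (word_map G w q)"
  using assms
proof (induction rule: pl_path.induct)
  case (refl p)
  then obtain e x where e: "e < N" "0 \<le> x" "x < 1" "p = edge_point C e x"
    by (rule realization_cycle_graph)
  show ?case using edge_point_in_realization[OF wf_\<Gamma> arc_in_arcs, of e "orient e x"] e orient_in[of x e]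
    by (simp add: word_map_edge_point pl_path.refl)
next
  case (step e x y r q)
  then have "e < N" by (simp add: cycle_graph_def)
  then show ?case
    using pl_path.step[OF arc_in_arcs, of e "orient e x" "orient e y"] step orient_in
    by (simp add: word_map_edge_point orient_diff)
qed

text \<open>Equal arcs have equal ends. As the vertices are distinct, \<open>k \<noteq> l\<close>
  would make each index the successor of the other modulo \<open>N\<close>, so \<open>N\<close>
  would divide 2.\<close>

lemma arc_inj:
  assumes "3 \<le> N" "inj_on vertex {..<N}" "k < N" "l < N" "arc k = arc l"
  shows "k = l"
proof -
  have "{tail \<Gamma> (arc k), head \<Gamma> (arc k)} = {tail \<Gamma> (arc l), head \<Gamma> (arc l)}"
    using assms by simp
  then have "{vertex k, vertex (Suc k mod N)} = {vertex l, vertex (Suc l mod N)}"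
    using assms(3,4) by (auto simp: arc_ends split: if_splits)
  moreover have "Suc k mod N < N" "Suc l mod N < N"
    by (rule mod_less_divisor, use assms(1) in linarith)+
  ultimately have "k = l \<or> (k = Suc l mod N \<and> l = Suc k mod N)"
    using assms(2-4) unfolding doubleton_eq_iff inj_on_def by (metis lessThan_iff)
  then show ?thesis using assms by (auto simp: mod_Suc split: if_splits)
qed

text \<open>A real-valued function on the vertices that changes by at most 1 along each edge extends to
  the realization by \<open>min (y + f (tail)) (1 - y + f (head))\<close>.  To bound distances from an
  interior point \<open>p\<close> of an edge, the extension is replaced on that edge by the distance to \<open>p\<close>.\<close>

theorem isometric_cycleI:
  fixes F :: "nat \<Rightarrow> 'a \<Rightarrow> int"
  assumes N: "3 \<le> N"
    and F_lip: "\<And>k g s. \<lbrakk>k < N; g \<in> carrier G; s \<in> S\<rbrakk> \<Longrightarrow> \<bar>F k g - F k (g \<otimes> s)\<bar> \<le> 1"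
    and F_cycle: "\<And>k l. \<lbrakk>k < N; l < N\<rbrakk> \<Longrightarrow> F k (vertex l) = cycle_dist N k l"
  shows "isometric_cycle G S w"
proof -
  have inj: "inj_on vertex {..<N}"
    by (intro inj_onI) (metis F_cycle cycle_dist_0_iff lessThan_iff)
  have lower: "\<exists>s \<le> r. pl_path C p s q"
    if p: "p \<in> realization C" and q: "q \<in> realization C"
      and path: "pl_path \<Gamma> (word_map G w p) r (word_map G w q)" for p q r
  proof -
    obtain e x where e: "e < N" "0 \<le> x" "x < 1" "p = edge_point C e x"
      using p by (rule realization_cycle_graph)
    obtain e' y where e': "e' < N" "0 \<le> y" "y < 1" "q = edge_point C e' y"
      using q by (rule realization_cycle_graph)
    define u where "u = Suc e mod N"
    define u' where "u' = Suc e' mod N"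
    have u: "u < N" "u' < N" unfolding u_def u'_def by (rule mod_less_divisor, use N in linarith)+
    \<comment> \<open>The distance from \<open>p\<close> that \<open>F\<close> predicts: leave the
      edge of \<open>p\<close> through \<open>e\<close> after length \<open>x\<close>, or through
      \<open>u\<close> after length \<open>1 - x\<close>.\<close>
    define f where "f g = min (x + F e g) (1 - x + F u g)" for g
    define h where "h P = (case P of Vertex g \<Rightarrow> f g
      | Inner a z \<Rightarrow> if a = arc e then \<bar>z - orient e x\<bar>
                    else min (z + f (tail \<Gamma> a)) (1 - z + f (head \<Gamma> a)))" for P
    have f_lip: "\<bar>f g - f (g \<otimes> s)\<bar> \<le> 1" if "g \<in> carrier G" "s \<in> S" for g s
      using F_lip[of e g s] F_lip[of u g s] that e(1) u(1) unfolding f_def by linarith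
    have f_ends: "f (vertex e) = x" "f (vertex u) = 1 - x"
      unfolding f_def using e u cycle_dist_Suc[of e N] N
      by (auto simp: F_cycle u_def cycle_dist_0_iff) (auto simp: cycle_dist_def)
    \<comment> \<open>At the two ends of this edge \<open>f\<close> equals the distance to
      \<open>p\<close> along it, so the two formulas in \<open>h\<close> fit together there.\<close>
    have h_own: "h (edge_point \<Gamma> (arc e) z) = \<bar>z - orient e x\<bar>" if "z \<in> {0..1}" for z
      using f_ends e that
      by (auto simp: h_def edge_point_def arc_ends[OF e(1)] u_def orient_def split: if_splits)
    \<comment> \<open>Since \<open>f\<close> changes by at most 1 along \<open>a\<close>, the
      minimum equals \<open>f\<close> at either end, so the formula also covers \<open>z = 0\<close>
      and \<open>z = 1\<close>.\<close>
    have h_other: "h (edge_point \<Gamma> a z) = min (z + f (tail \<Gamma> a)) (1 - z + f (head \<Gamma> a))"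
      if "a \<in> arcs \<Gamma>" "a \<noteq> arc e" for a z
    proof -
      have "\<bar>f (tail \<Gamma> a) - f (head \<Gamma> a)\<bar> \<le> 1"
        using that(1) f_lip by (auto simp: cayley_graph_def)
      then show ?thesis using that(2) by (auto simp: h_def edge_point_def)
    qed
    have h_lip: "\<bar>h (edge_point \<Gamma> a z) - h (edge_point \<Gamma> a z')\<bar> \<le> \<bar>z - z'\<bar>"
      if "a \<in> arcs \<Gamma>" "z \<in> {0..1}" "z' \<in> {0..1}" for a z z'
    proof (cases "a = arc e")
      case True
      then show ?thesis using h_own that by auto
    next
      case False
      then show ?thesis using h_other that by (auto simp: min_def)
    qed
    have "h (word_map G w p) = 0"
      using h_own orient_in[of x e] e by (simp add: word_map_edge_point)
    then have r: "h (word_map G w q) \<le> r"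
      using pl_path_lipschitz[OF path, of h] h_lip by fastforce
    have "\<exists>s \<le> h (word_map G w q). pl_path C p s q"
    proof (cases "e = e'")
      case True
      have "h (word_map G w q) = \<bar>x - y\<bar>"
        using True h_own[of "orient e y"] orient_in[of y e] e' orient_diff[of e y x]
        by (simp add: word_map_edge_point)
      then show ?thesis using pl_path_cycle_arc[of e N x y] e e' True by auto
    next
      case False
      have "arc e' \<noteq> arc e" using arc_inj[OF N inj] e e' False by metis
      then have hq: "h (word_map G w q) = min (y + f (vertex e')) (1 - y + f (vertex u'))"
        using h_other[OF arc_in_arcs[OF e'(1)], of "orient e' y"] e'
        by (auto simp: word_map_edge_point arc_ends orient_def u'_def min.commute)
      have p_e: "pl_path C p x (Vertex e)" "pl_path C p (1 - x) (Vertex u)"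
        using pl_path_cycle_arc[of e N x 0] pl_path_cycle_arc[of e N x 1] e
        by (auto simp: edge_point_def cycle_graph_def u_def abs_if split: if_splits)
      have q_e: "pl_path C (Vertex e') y q" "pl_path C (Vertex u') (1 - y) q"
        using pl_path_cycle_arc[of e' N 0 y] pl_path_cycle_arc[of e' N 1 y] e'
        by (auto simp: edge_point_def cycle_graph_def u'_def abs_if split: if_splits)
      have through: "pl_path C p (r1 + cycle_dist N k l + r2) q"
        if "pl_path C p r1 (Vertex k)" "pl_path C (Vertex l) r2 q" "k < N" "l < N" for r1 r2 k l
        using pl_path_trans[OF pl_path_trans[OF that(1) pl_path_cycle_dist[OF that(3,4)]] that(2)] .
      note t = through[OF p_e(1) q_e(1) e(1) e'(1)] through[OF p_e(1) q_e(2) e(1) u(2)]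
        through[OF p_e(2) q_e(1) u(1) e'(1)] through[OF p_e(2) q_e(2) u(1) u(2)]
      \<comment> \<open>Unfolding the minima leaves four routes, by either end of the edge of
        \<open>p\<close> and either end of the edge of \<open>q\<close>; each is a path on the
        cycle.\<close>
      have "h (word_map G w q) \<in>
        {x + cycle_dist N e e' + y, x + cycle_dist N e u' + (1 - y),
         1 - x + cycle_dist N u e' + y, 1 - x + cycle_dist N u u' + (1 - y)}"
        unfolding hq f_def using e(1) e'(1) u by (auto simp: F_cycle min_def)
      then show ?thesis using t by auto
    qed
    then show ?thesis using r by (meson order_trans)
  qed
  show ?thesis unfolding isometric_cycle_def
    using N w_lists w_closed lower pl_path_word_map
    by (auto intro!: path_dist_eqI)
qed

end

section \<open>Right multiplication in free groups\<close>

text \<open>\<open>reduce\<close> pushes letters on from the left, while edges of a Cayley graph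
  multiply on the right. In a reduced word the only possible cancellation is with the last
  letter.\<close>

lemma reduce_snoc:
  assumes "reduced x"
  shows "reduce (x @ [l]) = (if x \<noteq> [] \<and> last x = flip l then butlast x else x @ [l])"
proof (cases "x \<noteq> [] \<and> last x = flip l")
  case True
  then obtain z where z: "x = z @ [flip l]" by (metis append_butlast_last_id)
  have "reduced z" using assms unfolding z by (simp add: reduced_def successively_append_iff)
  then have "reduce (x @ [l]) = z" using reduce_reduced[of z] by (simp add: z reduce_def)
  then show ?thesis using True z by simp
next
  case False
  then have "reduced (x @ [l])"
    using assms by (auto simp: reduced_def successively_append_iff)
  then show ?thesis using False by (auto simp: reduce_reduced)
qed

definition exponent :: "'x \<Rightarrow> 'x word \<Rightarrow> int" where
  "exponent s w = (\<Sum>l\<leftarrow>w. if fst l = s then if snd l then 1 else - 1 else 0)"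

lemma exponent_simps [simp]:
  "exponent s [] = 0"
  "exponent s (l # w) = (if fst l = s then if snd l then 1 else - 1 else 0) + exponent s w"
  "exponent s (v @ w) = exponent s v + exponent s w"
  "exponent s (replicate k l) = int k * exponent s [l]"
  by (auto simp: exponent_def sum_list_replicate)

lemma exponent_reduce_snoc:
  assumes "reduced x"
  shows "exponent s (reduce (x @ [l])) = exponent s x + exponent s [l]"
proof (cases "x \<noteq> [] \<and> last x = flip l")
  case True
  then obtain z where "x = z @ [flip l]" by (metis append_butlast_last_id)
  then show ?thesis using reduce_snoc[OF assms, of l] by (auto simp: flip_def)
next
  case False
  then show ?thesis using reduce_snoc[OF assms, of l] by auto
qed

text \<open>The elements with prefix \<open>P @ [m]\<close> form one of the two components of the Cayley tree after
  the edge from \<open>P\<close> to \<open>P @ [m]\<close> is removed.\<close>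

lemma prefix_reduce_snoc:
  assumes "reduced x" "prefix (P @ [m]) (reduce (x @ [l])) \<noteq> prefix (P @ [m]) x"
  shows "x = P \<and> l = m \<or> x = P @ [m] \<and> l = flip m"
proof (cases "x \<noteq> [] \<and> last x = flip l")
  case True
  then obtain z where "x = z @ [flip l]" by (metis append_butlast_last_id)
  then show ?thesis using reduce_snoc[OF assms(1), of l] assms(2) by (auto simp: prefix_snoc)
next
  case False
  then have r: "reduce (x @ [l]) = x @ [l]" using reduce_snoc[OF assms(1), of l] by auto
  show ?thesis using assms(2) unfolding r prefix_snoc by auto
qed


section \<open>The group \<open>F(a,b) \<times> F(c,d)\<close>\<close>

lemma reduced_simps: "reduced []" "reduced [l]"
  by (simp_all add: reduced_def)

lemma carrier_FxF:
  "(x, y) \<in> carrier FxF \<longleftrightarrow> x \<in> lists ({sym_a, sym_b} \<times> UNIV) \<and> reduced x \<and>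
     y \<in> lists ({sym_c, sym_d} \<times> UNIV) \<and> reduced y"
  by (auto simp: FxF_def free_group_def DirProd_def)

lemma mult_FxF: "(x, y) \<otimes>\<^bsub>FxF\<^esub> (x', y') = (reduce (x @ x'), reduce (y @ y'))"
  by (simp add: FxF_def free_group_def DirProd_def)

lemma one_FxF: "\<one>\<^bsub>FxF\<^esub> = ([], [])"
  by (simp add: FxF_def free_group_def DirProd_def)

lemma inv_gen_b: "inv\<^bsub>FxF\<^esub> gen_b = ([(sym_b, False)], [])"
  by (rule group.inv_equality[OF group_FxF])
    (auto simp: gen_b_def mult_FxF one_FxF carrier_FxF reduced_simps reduce_def flip_def)

lemma gen_t_eq: "gen_t = ([(sym_b, False)], [(sym_d, True)])"
  by (simp add: gen_t_def inv_gen_b gen_d_def mult_FxF reduce_def)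

lemma gens_carrier: "gens \<subseteq> carrier FxF"
  by (auto simp: gens_def gen_a_def gen_b_def gen_c_def gen_t_eq carrier_FxF reduced_simps)

text \<open>\<open>height g\<close> and \<open>slack g\<close> are the exponent sums of \<open>t\<close> and \<open>b\<close> in any word over
  \<open>{a, b, c, t}\<close> that represents \<open>g\<close>.\<close>

definition side1 :: "symbol word \<times> symbol word \<Rightarrow> bool" where
  "side1 g = prefix [(sym_a, True)] (fst g)"

definition side2 :: "nat \<Rightarrow> symbol word \<times> symbol word \<Rightarrow> bool" where
  "side2 n g = prefix (replicate n (sym_d, True) @ [(sym_c, True)]) (snd g)"

definition height :: "symbol word \<times> symbol word \<Rightarrow> int" where
  "height g = exponent sym_d (snd g)"

definition slack :: "symbol word \<times> symbol word \<Rightarrow> int" where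
  "slack g = exponent sym_d (snd g) + exponent sym_b (fst g)"

text \<open>Multiplying by \<open>a\<close> changes \<open>side1\<close> only if the first component
  is empty; its exponent sum of \<open>b\<close> is then 0, so \<open>slack\<close> and
  \<open>height\<close> agree.\<close>

lemma step_a:
  assumes "g \<in> carrier FxF"
  shows "height (g \<otimes>\<^bsub>FxF\<^esub> gen_a) = height g" "slack (g \<otimes>\<^bsub>FxF\<^esub> gen_a) = slack g"
    "side2 n (g \<otimes>\<^bsub>FxF\<^esub> gen_a) = side2 n g"
    "side1 (g \<otimes>\<^bsub>FxF\<^esub> gen_a) \<noteq> side1 g \<Longrightarrow> slack g = height g"
proof -
  obtain x y where g: "g = (x, y)" by fastforce
  have xy: "reduced x" "reduced y" using assms by (auto simp: g carrier_FxF)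
  note * = g gen_a_def mult_FxF reduce_reduced xy exponent_reduce_snoc height_def slack_def side1_def side2_def
  show "height (g \<otimes>\<^bsub>FxF\<^esub> gen_a) = height g" "slack (g \<otimes>\<^bsub>FxF\<^esub> gen_a) = slack g"
    "side2 n (g \<otimes>\<^bsub>FxF\<^esub> gen_a) = side2 n g"
    by (simp_all add: *)
  show "slack g = height g" if "side1 (g \<otimes>\<^bsub>FxF\<^esub> gen_a) \<noteq> side1 g"
    using prefix_reduce_snoc[OF xy(1), of "[]" "(sym_a, True)" "(sym_a, True)"] that
    by (auto simp: *)
qed

lemma step_b:
  assumes "g \<in> carrier FxF"
  shows "height (g \<otimes>\<^bsub>FxF\<^esub> gen_b) = height g" "slack (g \<otimes>\<^bsub>FxF\<^esub> gen_b) = slack g + 1"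
    "side1 (g \<otimes>\<^bsub>FxF\<^esub> gen_b) = side1 g" "side2 n (g \<otimes>\<^bsub>FxF\<^esub> gen_b) = side2 n g"
proof -
  obtain x y where g: "g = (x, y)" by fastforce
  have xy: "reduced x" "reduced y" using assms by (auto simp: g carrier_FxF)
  note * = g gen_b_def mult_FxF reduce_reduced xy exponent_reduce_snoc height_def slack_def side1_def side2_def
  show "height (g \<otimes>\<^bsub>FxF\<^esub> gen_b) = height g" "slack (g \<otimes>\<^bsub>FxF\<^esub> gen_b) = slack g + 1"
    "side2 n (g \<otimes>\<^bsub>FxF\<^esub> gen_b) = side2 n g"
    by (simp_all add: *)
  show "side1 (g \<otimes>\<^bsub>FxF\<^esub> gen_b) = side1 g"
    using prefix_reduce_snoc[OF xy(1), of "[]" "(sym_a, True)" "(sym_b, True)"]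
    by (auto simp: * flip_def)
qed

text \<open>Multiplying by \<open>c\<close> changes \<open>side2\<close> only if the second
  component is \<open>d^n\<close>, which has height \<open>n\<close>.\<close>

lemma step_c:
  assumes "g \<in> carrier FxF"
  shows "height (g \<otimes>\<^bsub>FxF\<^esub> gen_c) = height g" "slack (g \<otimes>\<^bsub>FxF\<^esub> gen_c) = slack g"
    "side1 (g \<otimes>\<^bsub>FxF\<^esub> gen_c) = side1 g"
    "side2 n (g \<otimes>\<^bsub>FxF\<^esub> gen_c) \<noteq> side2 n g \<Longrightarrow> height g = int n"
proof -
  obtain x y where g: "g = (x, y)" by fastforce
  have xy: "reduced x" "reduced y" using assms by (auto simp: g carrier_FxF)
  note * = g gen_c_def mult_FxF reduce_reduced xy exponent_reduce_snoc height_def slack_def side1_def side2_def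
  show "height (g \<otimes>\<^bsub>FxF\<^esub> gen_c) = height g" "slack (g \<otimes>\<^bsub>FxF\<^esub> gen_c) = slack g"
    "side1 (g \<otimes>\<^bsub>FxF\<^esub> gen_c) = side1 g"
    by (simp_all add: *)
  show "height g = int n" if "side2 n (g \<otimes>\<^bsub>FxF\<^esub> gen_c) \<noteq> side2 n g"
    using prefix_reduce_snoc[OF xy(2), of "replicate n (sym_d, True)" "(sym_c, True)" "(sym_c, True)"] that
    by (auto simp: *)
qed

text \<open>The factors \<open>d\<close> and \<open>b^-1\<close> of \<open>t\<close> contribute 1
  and -1 to \<open>slack\<close> and cancel. The edges that separate the sides are labelled
  \<open>a\<close> and \<open>c\<close>, so neither is crossed.\<close>

lemma step_t:
  assumes "g \<in> carrier FxF"
  shows "height (g \<otimes>\<^bsub>FxF\<^esub> gen_t) = height g + 1" "slack (g \<otimes>\<^bsub>FxF\<^esub> gen_t) = slack g"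
    "side1 (g \<otimes>\<^bsub>FxF\<^esub> gen_t) = side1 g" "side2 n (g \<otimes>\<^bsub>FxF\<^esub> gen_t) = side2 n g"
proof -
  obtain x y where g: "g = (x, y)" by fastforce
  have xy: "reduced x" "reduced y" using assms by (auto simp: g carrier_FxF)
  note * = g gen_t_eq mult_FxF reduce_reduced xy exponent_reduce_snoc height_def slack_def side1_def side2_def
  show "height (g \<otimes>\<^bsub>FxF\<^esub> gen_t) = height g + 1" "slack (g \<otimes>\<^bsub>FxF\<^esub> gen_t) = slack g"
    by (simp_all add: *)
  show "side1 (g \<otimes>\<^bsub>FxF\<^esub> gen_t) = side1 g"
    using prefix_reduce_snoc[OF xy(1), of "[]" "(sym_a, True)" "(sym_b, False)"]
    by (auto simp: * flip_def)
  show "side2 n (g \<otimes>\<^bsub>FxF\<^esub> gen_t) = side2 n g"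
    using prefix_reduce_snoc[OF xy(2), of "replicate n (sym_d, True)" "(sym_c, True)" "(sym_d, True)"]
    by (auto simp: * flip_def)
qed


section \<open>The potential\<close>

lemma minmax_lipschitz:
  fixes a b c d e :: int
  assumes "\<bar>a - c\<bar> \<le> e" "\<bar>b - d\<bar> \<le> e"
  shows "\<bar>max a b - max c d\<bar> \<le> e" "\<bar>min a b - min c d\<bar> \<le> e"
  using assms by (auto simp: max_def min_def)

lemma lipschitz_add:
  fixes a b c e :: int
  assumes "\<bar>a - c\<bar> \<le> e"
  shows "\<bar>(b + a) - (b + c)\<bar> \<le> e" "\<bar>(a + b) - (c + b)\<bar> \<le> e"
  using assms by auto

text \<open>For \<open>0 \<le> i \<le> n\<close> this is modelled on the distance from the point \<open>(q, \<beta>) = (i, 0)\<close> of the first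
  sheet in the graph made of four copies of \<open>\<int>\<^sup>2\<close>, indexed by the two sides, where crossing side 1 is possible only on the
  diagonal \<open>q = \<beta>\<close> and crossing side 2 only on the line \<open>q = n\<close>.  A maximum arises as the length of
  a path by way of the diagonal (reflection principle), the minimum from the order of the crossings.\<close>

fun potential :: "int \<Rightarrow> int \<Rightarrow> bool \<Rightarrow> bool \<Rightarrow> int \<Rightarrow> int \<Rightarrow> int" where
  "potential n i False False q \<beta> = \<bar>q - i\<bar> + \<bar>\<beta>\<bar>"
| "potential n i False True q \<beta> = 1 + (n - i) + \<bar>q - n\<bar> + \<bar>\<beta>\<bar>"
| "potential n i True False q \<beta> = 1 + max (\<bar>q - i\<bar> + \<bar>\<beta>\<bar>) (\<bar>q\<bar> + \<bar>\<beta> - i\<bar>)"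
| "potential n i True True q \<beta> = 2 + min (\<bar>q - n\<bar> + max (n - i + \<bar>\<beta>\<bar>) (n + \<bar>\<beta> - i\<bar>))
                                         (n - i + max (\<bar>q - n\<bar> + \<bar>\<beta>\<bar>) (\<bar>q\<bar> + \<bar>\<beta> - n\<bar>))"

lemma potential_height: "\<bar>potential n i s1 s2 q \<beta> - potential n i s1 s2 (q + 1) \<beta>\<bar> \<le> 1"
  by (cases s1; cases s2; simp only: potential.simps; intro lipschitz_add minmax_lipschitz; linarith)

lemma potential_slack: "\<bar>potential n i s1 s2 q \<beta> - potential n i s1 s2 q (\<beta> + 1)\<bar> \<le> 1"
  by (cases s1; cases s2; simp only: potential.simps; intro lipschitz_add minmax_lipschitz; linarith)

text \<open>For \<open>s2 = False\<close> the two terms of the maximum coincide on the diagonal. For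
  \<open>s2 = True\<close> the minimum is attained there by the route that crosses side 1
  last.\<close>

lemma potential_side1:
  assumes "i \<le> n"
  shows "potential n i True s2 z z = potential n i False s2 z z + 1"
proof (cases s2)
  case True
  have "(n - i) + (\<bar>z - n\<bar> + \<bar>z\<bar>) \<le> \<bar>z - n\<bar> + max (n - i + \<bar>z\<bar>) (n + \<bar>z - i\<bar>)" by simp
  then show ?thesis using True by (simp add: add.commute)
qed (simp add: add.commute)

text \<open>On the line \<open>q = n\<close> the minimum is attained by the route that crosses side
  2 last, by the triangle inequality for \<open>i\<close>, \<open>n\<close> and
  \<open>\<beta>\<close>.\<close>

lemma potential_side2:
  assumes "0 \<le> i" "i \<le> n"
  shows "potential n i s1 True n \<beta> = potential n i s1 False n \<beta> + 1"
proof (cases s1)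
  case True
  have "max (n - i + \<bar>\<beta>\<bar>) (n + \<bar>\<beta> - i\<bar>) \<le> n - i + max \<bar>\<beta>\<bar> (n + \<bar>\<beta> - n\<bar>)"
    using assms by linarith
  then show ?thesis using assms True by (simp add: min_absorb1)
qed (use assms in auto)


section \<open>The vertices of the cycle\<close>

text \<open>For \<open>i \<le> n\<close> this is the vertex of the cycle on the sheet
  \<open>(s1, s2)\<close> at height \<open>i\<close>. After \<open>d^n c\<close> the trailing
  inverses of \<open>d\<close> bring the height back down to \<open>i\<close>.\<close>

definition grid :: "nat \<Rightarrow> bool \<Rightarrow> bool \<Rightarrow> nat \<Rightarrow> symbol word \<times> symbol word" where
  "grid n s1 s2 i =
     ((if s1 then [(sym_a, True)] else []) @ replicate i (sym_b, False),
      if s2 then replicate n (sym_d, True) @ [(sym_c, True)] @ replicate (n - i) (sym_d, False)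
      else replicate i (sym_d, True))"

definition position :: "nat \<Rightarrow> bool \<Rightarrow> bool \<Rightarrow> nat \<Rightarrow> nat" where
  "position n s1 s2 i =
     (if s1 then if s2 then 2 * n + 2 + i else 4 * n + 3 - i
      else if s2 then 2 * n + 1 - i else i)"

text \<open>At slack 0 the four formulas become \<open>|j - i|\<close>,
  \<open>1 + 2n - i - j\<close>, \<open>1 + i + j\<close> and \<open>2 + 2n - |j - i|\<close>, the
  lengths of the shorter arcs. Only differences of bits enter, because the cycle looks alike from
  each of its four sides.\<close>

lemma potential_grid:
  assumes "i \<le> n" "j \<le> n"
  shows "potential (int n) (int i) (s1' \<noteq> s1) (s2' \<noteq> s2) (int j) 0
    = cycle_dist (4 * n + 4) (position n s1 s2 i) (position n s1' s2' j)"
  using assms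
  by (cases s1; cases s2; cases s1'; cases s2') (auto simp: position_def cycle_dist_def)

lemma reduced_replicate: "reduced (replicate k l)"
  by (induction k) (auto simp: reduced_def successively_Cons flip_def prod_eq_iff)

lemma grid_carrier: "grid n s1 s2 i \<in> carrier FxF"
  using reduced_replicate
  by (cases "n = 0") (auto simp: grid_def carrier_FxF reduced_def successively_append_iff successively_Cons
      hd_append flip_def)

lemma reduced_grid: "reduced (fst (grid n s1 s2 i))" "reduced (snd (grid n s1 s2 i))"
  using grid_carrier[of n s1 s2 i] carrier_FxF[of "fst (grid n s1 s2 i)" "snd (grid n s1 s2 i)"]
  by simp_all

lemma grid_invariants:
  assumes "i \<le> n"
  shows "side1 (grid n s1 s2 i) = s1" "side2 n (grid n s1 s2 i) = s2"
    "height (grid n s1 s2 i) = int i" "slack (grid n s1 s2 i) = 0"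
proof -
  show "side1 (grid n s1 s2 i) = s1"
    by (cases i) (auto simp: side1_def grid_def)
  have "\<not> prefix (replicate n (sym_d, True) @ [(sym_c, True)]) (replicate i (sym_d, True))"
    using set_mono_prefix by fastforce
  then show "side2 n (grid n s1 s2 i) = s2"
    by (auto simp: side2_def grid_def)
qed (use assms in \<open>auto simp: height_def slack_def grid_def\<close>)

lemma grid_a: "grid n False s2 0 \<otimes>\<^bsub>FxF\<^esub> gen_a = grid n True s2 0"
  using grid_carrier[of n False s2 0]
  by (auto simp: grid_def gen_a_def mult_FxF carrier_FxF reduce_reduced reduced_simps)

lemma grid_c: "grid n s1 False n \<otimes>\<^bsub>FxF\<^esub> gen_c = grid n s1 True n"
  using grid_carrier[of n s1 False n]
  by (auto simp: grid_def gen_c_def mult_FxF carrier_FxF reduce_reduced reduced_simps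
      reduce_snoc flip_def)

lemma grid_t:
  assumes "i < n"
  shows "grid n s1 s2 i \<otimes>\<^bsub>FxF\<^esub> gen_t = grid n s1 s2 (Suc i)"
proof -
  have x: "fst (grid n s1 s2 i) @ [(sym_b, False)] = fst (grid n s1 s2 (Suc i))"
    by (simp add: grid_def replicate_append_same)
  have "reduce (snd (grid n s1 s2 i) @ [(sym_d, True)]) = snd (grid n s1 s2 (Suc i))"
  proof (cases s2)
    case True
    \<comment> \<open>As \<open>i < n\<close>, a letter \<open>d^-1\<close> is still left at the end
      and cancels against the \<open>d\<close> of \<open>t\<close>.\<close>
    obtain k where "n - i = Suc k" "n - Suc i = k" using assms by (metis Suc_diff_Suc)
    then have "snd (grid n s1 s2 i) = snd (grid n s1 s2 (Suc i)) @ [(sym_d, False)]"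
      using True by (simp add: grid_def replicate_append_same)
    then show ?thesis using reduce_snoc[OF reduced_grid(2)[of n s1 s2 i]] by (simp add: flip_def)
  next
    case False
    then have "snd (grid n s1 s2 i) @ [(sym_d, True)] = snd (grid n s1 s2 (Suc i))"
      by (simp add: grid_def replicate_append_same)
    then show ?thesis using reduced_grid reduce_reduced by metis
  qed
  then show ?thesis
    using mult_FxF[of "fst (grid n s1 s2 i)" "snd (grid n s1 s2 i)"] x
    by (simp add: gen_t_eq reduce_reduced reduced_grid)
qed

text \<open>An inverse letter follows an edge backwards, so it suffices that \<open>s\<close> leads
  from \<open>g'\<close> to \<open>g\<close>. Thus \<open>grid_a\<close>, \<open>grid_c\<close> and
  \<open>grid_t\<close> also serve the inverse letters of the word.\<close>

lemma word_value_snoc_gens: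
  assumes "word_value FxF u = g" "u \<in> lists (gens \<times> UNIV)" "s \<in> gens"
  shows "word_value FxF (u @ [(s, True)]) = g \<otimes>\<^bsub>FxF\<^esub> s"
    and "g' \<in> carrier FxF \<Longrightarrow> g' \<otimes>\<^bsub>FxF\<^esub> s = g \<Longrightarrow> word_value FxF (u @ [(s, False)]) = g'"
proof -
  interpret group FxF by (rule group_FxF)
  have s: "s \<in> carrier FxF" using assms(3) gens_carrier by blast
  note v = word_value_snoc[OF group_FxF gens_carrier assms(2)]
  show "word_value FxF (u @ [(s, True)]) = g \<otimes>\<^bsub>FxF\<^esub> s"
    using v[of "(s, True)"] assms by (simp add: letter_value_def)
  show "word_value FxF (u @ [(s, False)]) = g'" if "g' \<in> carrier FxF" "g' \<otimes>\<^bsub>FxF\<^esub> s = g"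
  proof -
    have "g \<otimes>\<^bsub>FxF\<^esub> inv\<^bsub>FxF\<^esub> s = g'" using that s by (auto simp: m_assoc)
    then show ?thesis using v[of "(s, False)"] assms by (simp add: letter_value_def)
  qed
qed

lemma gens_simps: "gen_a \<in> gens" "gen_b \<in> gens" "gen_c \<in> gens" "gen_t \<in> gens"
  by (auto simp: gens_def)

lemma walk_up:
  assumes "word_value FxF u = grid n s1 s2 0" "u \<in> lists (gens \<times> UNIV)" "j \<le> n"
  shows "word_value FxF (u @ replicate j (gen_t, True)) = grid n s1 s2 j"
  using assms(3)
proof (induction j)
  case (Suc j)
  have *: "u @ replicate (Suc j) (gen_t, True) = (u @ replicate j (gen_t, True)) @ [(gen_t, True)]"
    by (simp add: replicate_append_same)
  have l: "u @ replicate j (gen_t, True) \<in> lists (gens \<times> UNIV)"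
    using assms(2) gens_simps(4) by auto
  from Suc show ?case unfolding * by (simp add: word_value_snoc_gens(1)[OF _ l] gens_simps grid_t del: append_assoc)
qed (use assms in simp)

lemma walk_down:
  assumes "word_value FxF u = grid n s1 s2 n" "u \<in> lists (gens \<times> UNIV)" "j \<le> n"
  shows "word_value FxF (u @ replicate j (gen_t, False)) = grid n s1 s2 (n - j)"
  using assms(3)
proof (induction j)
  case (Suc j)
  have *: "u @ replicate (Suc j) (gen_t, False) = (u @ replicate j (gen_t, False)) @ [(gen_t, False)]"
    by (simp add: replicate_append_same)
  have l: "u @ replicate j (gen_t, False) \<in> lists (gens \<times> UNIV)"
    using assms(2) gens_simps(4) by auto
  have "Suc (n - Suc j) = n - j" using Suc.prems by simp
  then have t: "grid n s1 s2 (n - Suc j) \<otimes>\<^bsub>FxF\<^esub> gen_t = grid n s1 s2 (n - j)"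
    using grid_t[of "n - Suc j" n s1 s2] Suc.prems by simp
  show ?case unfolding *
    using Suc by (intro word_value_snoc_gens(2)[OF _ l gens_simps(4) grid_carrier t]) simp
qed (use assms in simp)

lemma w_word_lists: "w_word n \<in> lists (gens \<times> UNIV)"
  by (auto simp: w_word_def gens_simps)

lemma length_w_word: "length (w_word n) = 4 * n + 4"
  by (simp add: w_word_def)

text \<open>The path runs along the four sides of the grid in the order up, down, up, down.\<close>

lemma w_word_vertices:
  assumes "j \<le> n"
  shows "word_value FxF (take j (w_word n)) = grid n False False j"
    and "word_value FxF (take (n + 1 + j) (w_word n)) = grid n False True (n - j)"
    and "word_value FxF (take (2 * n + 2 + j) (w_word n)) = grid n True True j"
    and "word_value FxF (take (3 * n + 3 + j) (w_word n)) = grid n True False (n - j)"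
    and "word_value FxF (w_word n) = \<one>\<^bsub>FxF\<^esub>"
proof -
  let ?up = "\<lambda>j. replicate j (gen_t, True)" and ?down = "\<lambda>j. replicate j (gen_t, False)"
  define u1 where "u1 = ?up n @ [(gen_c, True)]"
  define u2 where "u2 = (u1 @ ?down n) @ [(gen_a, True)]"
  define u3 where "u3 = (u2 @ ?up n) @ [(gen_c, False)]"
  note u = u1_def u2_def u3_def
  have w: "w_word n = (u3 @ ?down n) @ [(gen_a, False)]"
    by (simp add: u w_word_def)
  have lists: "?up n \<in> lists (gens \<times> UNIV)" "u1 \<in> lists (gens \<times> UNIV)"
      "u1 @ ?down n \<in> lists (gens \<times> UNIV)" "u2 \<in> lists (gens \<times> UNIV)"
      "u2 @ ?up n \<in> lists (gens \<times> UNIV)" "u3 \<in> lists (gens \<times> UNIV)"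
      "u3 @ ?down n \<in> lists (gens \<times> UNIV)"
    by (auto simp: u gens_simps)
  have up1: "word_value FxF (?up j) = grid n False False j" if "j \<le> n" for j
    using walk_up[of "[]" n False False j] that by (simp add: word_value_def one_FxF grid_def)
  have "word_value FxF u1 = grid n False True n"
    unfolding u1_def
    using word_value_snoc_gens(1)[OF up1[OF order.refl] lists(1) gens_simps(3)] by (simp add: grid_c)
  note down1 = walk_down[OF this lists(2)]
  have "word_value FxF u2 = grid n True True 0"
    unfolding u2_def
    using word_value_snoc_gens(1)[OF down1[OF order.refl] lists(3) gens_simps(1)] by (simp add: grid_a)
  note up2 = walk_up[OF this lists(4)]
  have "word_value FxF u3 = grid n True False n"
    unfolding u3_def
    using word_value_snoc_gens(2)[OF up2[OF order.refl] lists(5) gens_simps(3) grid_carrier grid_c] .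
  note down2 = walk_down[OF this lists(6)]
  \<comment> \<open>The final \<open>a^-1\<close> leads from height 0 on the fourth side back to the
    start; \<open>n - n\<close> is the height as \<open>walk_down\<close> delivers it.\<close>
  have "word_value FxF (w_word n) = grid n False False (n - n)"
    unfolding w
    by (rule word_value_snoc_gens(2)[OF down2[OF order.refl] lists(7) gens_simps(1) grid_carrier])
      (simp add: grid_a)
  then show "word_value FxF (w_word n) = \<one>\<^bsub>FxF\<^esub>" by (simp add: one_FxF grid_def)
  have len: "length u1 = n + 1" "length u2 = 2 * n + 2" "length u3 = 3 * n + 3"
    by (simp_all add: u)
  have "take j (w_word n) = ?up j" using assms by (simp add: w_word_def)
  then show "word_value FxF (take j (w_word n)) = grid n False False j"
    using up1[OF assms] by simp
  have "take (n + 1 + j) (w_word n) = u1 @ ?down j" using assms by (simp add: w u3_def u2_def len)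
  then show "word_value FxF (take (n + 1 + j) (w_word n)) = grid n False True (n - j)"
    using down1[OF assms] by simp
  have "take (2 * n + 2 + j) (w_word n) = u2 @ ?up j" using assms by (simp add: w u3_def len)
  then show "word_value FxF (take (2 * n + 2 + j) (w_word n)) = grid n True True j"
    using up2[OF assms] by simp
  have "take (3 * n + 3 + j) (w_word n) = u3 @ ?down j" using assms by (simp add: w len)
  then show "word_value FxF (take (3 * n + 3 + j) (w_word n)) = grid n True False (n - j)"
    using down2[OF assms] by simp
qed

lemma w_word_vertex_cases:
  assumes "k < 4 * n + 4"
  obtains s1 s2 i where "i \<le> n" "k = position n s1 s2 i"
    "word_value FxF (take k (w_word n)) = grid n s1 s2 i"
proof -
  consider "k \<le> n" | "n + 1 \<le> k" "k \<le> 2 * n + 1" | "2 * n + 2 \<le> k" "k \<le> 3 * n + 2"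
    | "3 * n + 3 \<le> k" "k \<le> 4 * n + 3" using assms by linarith
  then show thesis
  proof cases
    case 1
    then show ?thesis
      using that[of k False False] w_word_vertices(1)[of k n] by (simp add: position_def)
  next
    case 2
    then show ?thesis
      using that[of "n - (k - (n + 1))" False True] w_word_vertices(2)[of "k - (n + 1)" n]
      by (simp add: position_def)
  next
    case 3
    define j where "j = k - (2 * n + 2)"
    have "k = 2 * n + 2 + j" "j \<le> n" using 3 by (simp_all add: j_def)
    then show ?thesis
      using that[of j True True] w_word_vertices(3)[of j n] by (simp add: position_def)
  next
    case 4
    then show ?thesis
      using that[of "n - (k - (3 * n + 3))" True False] w_word_vertices(4)[of "k - (3 * n + 3)" n]
      by (simp add: position_def)
  qed
qed

lemma isometric_cycle_w_word: "isometric_cycle FxF gens (w_word n)"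
proof -
  interpret closed_word FxF gens "w_word n"
    by (intro closed_word.intro closed_word_axioms.intro group_FxF gens_carrier w_word_lists
        w_word_vertices(5)[OF le0])
  \<comment> \<open>Comparing the bits with those of \<open>vertex k\<close> puts that vertex on the
    first sheet of \<open>potential\<close>. Its height supplies \<open>i\<close>, and its slack is
    0, as the model requires.\<close>
  define F where "F k g = potential (int n) (height (vertex k))
    (side1 g \<noteq> side1 (vertex k)) (side2 n g \<noteq> side2 n (vertex k)) (height g) (slack g)" for k g
  show ?thesis
  proof (rule isometric_cycleI[of F])
    fix k g s assume k: "k < length (w_word n)" and g: "g \<in> carrier FxF" and s: "s \<in> gens"
    obtain s1 s2 i where i: "i \<le> n" "vertex k = grid n s1 s2 i"
      using w_word_vertex_cases[of k n] k unfolding length_w_word vertex_def by metis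
    have h: "0 \<le> height (vertex k)" "height (vertex k) \<le> int n"
      using i grid_invariants by auto
    from s consider "s = gen_a" | "s = gen_b" | "s = gen_c" | "s = gen_t"
      by (auto simp: gens_def)
    then show "\<bar>F k g - F k (g \<otimes>\<^bsub>FxF\<^esub> s)\<bar> \<le> 1"
    proof cases
      case 1
      show ?thesis
      proof (cases "side1 (g \<otimes>\<^bsub>FxF\<^esub> s) = side1 g")
        case True
        then show ?thesis using step_a[OF g] 1 by (simp add: F_def)
      next
        case False
        then have "slack g = height g" using step_a(4)[OF g] 1 by simp
        then show ?thesis
          using step_a(1-3)[OF g] 1 False potential_side1[OF h(2)]
          by (cases "side1 g \<noteq> side1 (vertex k)") (auto simp: F_def)
      qed
    next
      case 2
      then show ?thesis using potential_slack by (simp add: F_def step_b[OF g])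
    next
      case 3
      show ?thesis
      proof (cases "side2 n (g \<otimes>\<^bsub>FxF\<^esub> s) = side2 n g")
        case True
        then show ?thesis using step_c[OF g] 3 by (simp add: F_def)
      next
        case False
        then have "height g = int n" using step_c(4)[OF g] 3 by simp
        then show ?thesis
          using step_c(1-3)[OF g] 3 False potential_side2[OF h]
          by (cases "side2 n g \<noteq> side2 n (vertex k)") (auto simp: F_def)
      qed
    next
      case 4
      then show ?thesis using potential_height by (simp add: F_def step_t[OF g])
    qed
  next
    fix k l assume k: "k < length (w_word n)" and l: "l < length (w_word n)"
    obtain s1 s2 i where i: "i \<le> n" "k = position n s1 s2 i" "vertex k = grid n s1 s2 i"
      using w_word_vertex_cases[of k n] k unfolding length_w_word vertex_def by metis
    obtain s1' s2' j where j: "j \<le> n" "l = position n s1' s2' j" "vertex l = grid n s1' s2' j"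
      using w_word_vertex_cases[of l n] l unfolding length_w_word vertex_def by metis
    show "F k (vertex l) = cycle_dist (length (w_word n)) k l"
      unfolding F_def i(3) j(3) length_w_word
      using potential_grid[OF i(1) j(1), of s1' s1 s2' s2]
      by (simp add: grid_invariants i(1,2) j(1,2))
  qed (simp add: length_w_word)
qed

theorem mainTheorem3:
  shows "(\<forall>n. w_word n \<in> lists (gens \<times> UNIV) \<and> length (w_word n) = 4 * n + 4 \<and>
              word_value FxF (w_word n) = \<one>\<^bsub>FxF\<^esub> \<and>
              isometric_cycle FxF gens (w_word n)) \<and>
         \<not> (\<exists>M. \<forall>w. isometric_cycle FxF gens w \<longrightarrow> length w \<le> M)"
proof -
  have "\<exists>w. isometric_cycle FxF gens w \<and> \<not> length w \<le> M" for M
    by (rule exI[of _ "w_word M"]) (simp add: isometric_cycle_w_word length_w_word)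
  then show ?thesis
    using w_word_lists length_w_word w_word_vertices(5)[OF le0] isometric_cycle_w_word by blast
qed

end
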